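(* Let $N\ge 2$ and $n\ge 1$ be integers, and let $(\mathbf{X}(t))_{t\in\mathbb{N}_0}$ be the discrete coagulation-fragmentation Markov chain on $S_{N-1}^{(n)}=n\Delta_{N-1}\cap\mathbb{Z}^N$. Then the (unique) invariant distribution of this Markov chain is the uniform distribution on $n\Delta_{N-1}\cap\mathbb{Z}^N$.
   Context: Here $S_{N-1}^{(n)}=n\Delta_{N-1}\cap\mathbb{Z}^N=\{\mathbf{n}=(n_1,\ldots,n_N): n_i\in\mathbb{N}_0,\ 0\le n_i\le n,\ \sum_{i=1}^N n_i=n\}$. The discrete coagulation-fragmentation Markov chain on $S_{N-1}^{(n)}$ is the time-homogeneous chain with one-step transition probabilities $$\mathbb{P}\{\mathbf{X}(t+1)=\mathbf{n}'\mid \mathbf{X}(t)=\mathbf{n}\}=\sum_{(i,j):\, i\ne j}\frac{1}{N}\,\frac{1}{N-1}\,\frac{1}{n_i+n_j+1}\,\delta_{n_i+n_j,\;n_i'+n_j'}\prod_{k\ne i,j}\delta_{n_k',\,n_k},$$ where the sum is over all ordered pairs $(i,j)$ of distinct indices in $\{1,\ldots,N\}$ and $\delta_{a,b}$ is the Kronecker delta. In words: an ordered pair of distinct indices is chosen uniformly at random, and $(n_i,n_j)$ is replaced by $(n_i',\,n_i+n_j-n_i')$ with $n_i'$ uniform on $\{0,1,\ldots,n_i+n_j\}$. *)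

theory Defs
  imports "HOL-Probability.Probability"
begin

text \<open>Points of the lattice simplex are functions on the index set \<open>{1..N}\<close>. They are taken
  extensional (\<open>\<rightarrow>\<^sub>E\<close>, constant \<open>undefined\<close> off \<open>{1..N}\<close>), so that equality of functions is
  equality of coordinate vectors.\<close>

definition lattice_simplex :: "nat \<Rightarrow> nat \<Rightarrow> (nat \<Rightarrow> nat) set" where
  "lattice_simplex N n = {x \<in> {1..N} \<rightarrow>\<^sub>E {0..n}. (\<Sum>i\<in>{1..N}. x i) = n}"

text \<open>One-step transition probability from \<open>x\<close> to \<open>y\<close>; \<open>of_bool (a = b)\<close> is the Kronecker
  delta, and the sum is over ordered pairs of distinct indices.\<close>

definition cf_transition :: "nat \<Rightarrow> (nat \<Rightarrow> nat) \<Rightarrow> (nat \<Rightarrow> nat) \<Rightarrow> real" where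
  "cf_transition N x y =
     (\<Sum>(i, j) \<in> {(i, j). i \<in> {1..N} \<and> j \<in> {1..N} \<and> i \<noteq> j}.
        1 / real N * (1 / (real N - 1)) * (1 / (real (x i) + real (x j) + 1)) *
        of_bool (x i + x j = y i + y j) * (\<Prod>k \<in> {1..N} - {i, j}. of_bool (y k = x k)))"

definition invariant_distribution :: "'a set \<Rightarrow> ('a \<Rightarrow> 'a \<Rightarrow> real) \<Rightarrow> 'a pmf \<Rightarrow> bool" where
  "invariant_distribution S P \<pi> \<longleftrightarrow>
     set_pmf \<pi> \<subseteq> S \<and> (\<forall>y\<in>S. pmf \<pi> y = (\<Sum>x\<in>S. pmf \<pi> x * P x y))"

lemma finite_lattice_simplex: "finite (lattice_simplex N n)"
  unfolding lattice_simplex_def by (rule finite_subset[OF _ finite_PiE[of "{1..N}" "\<lambda>_. {0..n}"]]) auto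

lemma lattice_simplex_nonempty:
  assumes "N \<ge> 1"
  shows "lattice_simplex N n \<noteq> {}"
proof -
  have "(\<lambda>i\<in>{1..N}. if i = 1 then n else 0) \<in> lattice_simplex N n"
    using assms by (auto simp: lattice_simplex_def)
  thus ?thesis by blast
qed

lemma cf_transition_nonneg:
  assumes "N \<ge> 1"
  shows "cf_transition N x y \<ge> 0"
  unfolding cf_transition_def using assms
  by (intro sum_nonneg) (auto intro!: divide_nonneg_nonneg mult_nonneg_nonneg prod_nonneg)

lemma card_fragmentations:
  assumes x: "x \<in> lattice_simplex N n" and ij: "i \<in> {1..N}" "j \<in> {1..N}" "i \<noteq> j"
  shows "card {y \<in> lattice_simplex N n. x i + x j = y i + y j \<and> (\<forall>k\<in>{1..N} - {i, j}. y k = x k)}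
           = x i + x j + 1"
proof -
  let ?A = "{y \<in> lattice_simplex N n. x i + x j = y i + y j \<and> (\<forall>k\<in>{1..N} - {i, j}. y k = x k)}"
  let ?s = "x i + x j"
  let ?f = "\<lambda>a. x(i := a, j := ?s - a)"
  have split: "(\<Sum>k\<in>{1..N}. z k) = z i + z j + (\<Sum>k\<in>{1..N} - {i, j}. z k)" for z :: "nat \<Rightarrow> nat"
  proof -
    have "(\<Sum>k\<in>{1..N}. z k) = (\<Sum>k\<in>{i, j}. z k) + (\<Sum>k\<in>{1..N} - {i, j}. z k)"
      using ij by (subst sum.subset_diff[of "{i, j}"]) auto
    thus ?thesis using ij by simp
  qed
  have xP: "x \<in> {1..N} \<rightarrow>\<^sub>E {0..n}" and xs: "(\<Sum>k\<in>{1..N}. x k) = n"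
    using x by (auto simp: lattice_simplex_def)
  have sn: "?s \<le> n" using split[of x] xs by simp
  have "bij_betw ?f {0..?s} ?A"
  proof (rule bij_betw_byWitness[where f' = "\<lambda>y. y i"])
    show "\<forall>a\<in>{0..?s}. ?f a i = a" using ij by auto
  next
    show "\<forall>y\<in>?A. ?f (y i) = y"
    proof (intro ballI ext)
      fix y k assume y: "y \<in> ?A"
      show "?f (y i) k = y k"
      proof (cases "k \<in> {1..N}")
        case True thus ?thesis using y ij by auto
      next
        case False
        hence "x k = undefined" "y k = undefined"
          using y xP by (auto simp: lattice_simplex_def PiE_def extensional_def)
        thus ?thesis using False ij by auto
      qed
    qed
  next
    show "?f ` {0..?s} \<subseteq> ?A"
    proof
      fix y assume "y \<in> ?f ` {0..?s}"
      then obtain a where a: "a \<le> ?s" "y = ?f a" by auto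
      have "(\<Sum>k\<in>{1..N} - {i, j}. y k) = (\<Sum>k\<in>{1..N} - {i, j}. x k)"
        using a by (intro sum.cong) auto
      hence "(\<Sum>k\<in>{1..N}. y k) = n" using split[of y] split[of x] xs a ij by simp
      moreover have "y \<in> {1..N} \<rightarrow>\<^sub>E {0..n}"
        using xP a sn ij by (auto simp: PiE_def extensional_def Pi_def)
      ultimately show "y \<in> ?A" using a ij by (auto simp: lattice_simplex_def)
    qed
  next
    show "(\<lambda>y. y i) ` ?A \<subseteq> {0..?s}" by auto
  qed
  from bij_betw_same_card[OF this] show ?thesis by simp
qed

lemma card_ordered_pairs:
  "card {(i, j). i \<in> {1..N} \<and> j \<in> {1..N} \<and> i \<noteq> j} = N * (N - 1)"
proof -
  have "{(i, j). i \<in> {1..N} \<and> j \<in> {1..N} \<and> i \<noteq> j} = (SIGMA i:{1..N}. {1..N} - {i})" by auto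
  thus ?thesis by simp
qed

lemma sum_cf_transition:
  assumes "N \<ge> 2" and x: "x \<in> lattice_simplex N n"
  shows "(\<Sum>y\<in>lattice_simplex N n. cf_transition N x y) = 1"
proof -
  let ?S = "lattice_simplex N n"
  let ?I = "{(i, j). i \<in> {1..N} \<and> j \<in> {1..N} \<and> i \<noteq> j}"
  let ?c = "1 / real N * (1 / (real N - 1))"
  have "(\<Sum>y\<in>?S. cf_transition N x y) =
    (\<Sum>(i, j)\<in>?I. \<Sum>y\<in>?S. ?c * (1 / (real (x i) + real (x j) + 1)) *
        of_bool (x i + x j = y i + y j) * (\<Prod>k \<in> {1..N} - {i, j}. of_bool (y k = x k)))"
    unfolding cf_transition_def by (subst sum.swap) (simp add: case_prod_unfold)
  also have "\<dots> = (\<Sum>(i, j)\<in>?I. ?c)"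
  proof (rule sum.cong[OF refl], clarify)
    fix i j assume ij: "i \<in> {1..N}" "j \<in> {1..N}" "i \<noteq> j"
    let ?A = "{y \<in> ?S. x i + x j = y i + y j \<and> (\<forall>k\<in>{1..N} - {i, j}. y k = x k)}"
    have p: "(\<Prod>k \<in> {1..N} - {i, j}. of_bool (y k = x k) :: real) =
        of_bool (\<forall>k\<in>{1..N} - {i, j}. y k = x k)" for y
      by (cases "\<forall>k\<in>{1..N} - {i, j}. y k = x k") (auto intro!: prod_zero)
    have "(\<Sum>y\<in>?S. ?c * (1 / (real (x i) + real (x j) + 1)) *
        of_bool (x i + x j = y i + y j) * (\<Prod>k \<in> {1..N} - {i, j}. of_bool (y k = x k)))
      = (\<Sum>y\<in>?S. if y \<in> ?A then ?c * (1 / (real (x i) + real (x j) + 1)) else 0)"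
      unfolding p by (intro sum.cong) auto
    also have "\<dots> = (\<Sum>y\<in>?A. ?c * (1 / (real (x i) + real (x j) + 1)))"
      by (rule sum.mono_neutral_cong_right) (auto simp: finite_lattice_simplex)
    also have "\<dots> = real (card ?A) * (?c * (1 / (real (x i) + real (x j) + 1)))"
      by (rule sum_constant)
    also have "\<dots> = ?c"
      unfolding card_fragmentations[OF x ij] by simp (simp add: divide_simps)
    finally show "(\<Sum>y\<in>?S. ?c * (1 / (real (x i) + real (x j) + 1)) *
        of_bool (x i + x j = y i + y j) * (\<Prod>k \<in> {1..N} - {i, j}. of_bool (y k = x k))) = ?c" .
  qed
  also have "\<dots> = real (card ?I) * ?c" by (simp only: case_prod_unfold sum_constant)
  also have "\<dots> = 1"
    unfolding card_ordered_pairs using assms(1) by (simp add: of_nat_diff)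
  finally show ?thesis .
qed

end

theory Submission
  imports Defs
begin

text \<open>
  The transition matrix is symmetric: a step through the pair \<open>(i, j)\<close> preserves the sum of the
  two entries, so the number of possible outcomes is the same seen from either end of the step
  (\<open>cf_transition_commute\<close>). A symmetric stochastic matrix is doubly stochastic, so the uniform
  distribution is invariant.

  For uniqueness, symmetry makes the mass function \<open>f\<close> of an invariant distribution a harmonic
  function, and its Dirichlet form \<open>\<Sum>x y. P x y * (f x - f y)\<^sup>2\<close> then vanishes. Hence \<open>f\<close> is
  constant along transitions of positive probability
  (\<open>harmonic_eq_along_transitions\<close>). The chain is irreducible because every state can be driven to
  one fixed corner of the simplex by coagulating all the other coordinates, one after the other,
  into the first (\<open>coagulation_reaches_corner\<close>); so \<open>f\<close> is constant.
\<close>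

section \<open>Symmetric transition matrices on a finite state space\<close>

text \<open>Expanding the square, each of the two pure terms contributes \<open>\<Sum>x. (f x)\<^sup>2\<close> (by unit row
  sums, and by unit column sums, which symmetry provides), and by harmonicity the mixed term
  contributes minus twice that.\<close>

lemma harmonic_dirichlet_form_zero:
  fixes P :: "'a \<Rightarrow> 'a \<Rightarrow> real" and f :: "'a \<Rightarrow> real"
  assumes sym: "\<And>x y. x \<in> S \<Longrightarrow> y \<in> S \<Longrightarrow> P x y = P y x"
    and row: "\<And>x. x \<in> S \<Longrightarrow> (\<Sum>y\<in>S. P x y) = 1"
    and harm: "\<And>x. x \<in> S \<Longrightarrow> f x = (\<Sum>y\<in>S. P x y * f y)"
  shows "(\<Sum>x\<in>S. \<Sum>y\<in>S. P x y * (f x - f y)\<^sup>2) = 0"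
proof -
  have rows: "(\<Sum>x\<in>S. \<Sum>y\<in>S. P x y * (f x)\<^sup>2) = (\<Sum>x\<in>S. (f x)\<^sup>2)"
    by (intro sum.cong refl) (simp add: sum_distrib_right[symmetric] row)
  have "(\<Sum>x\<in>S. \<Sum>y\<in>S. P x y * (f y)\<^sup>2) = (\<Sum>y\<in>S. \<Sum>x\<in>S. P y x * (f y)\<^sup>2)"
    by (subst sum.swap) (intro sum.cong refl, simp add: sym)
  hence columns: "(\<Sum>x\<in>S. \<Sum>y\<in>S. P x y * (f y)\<^sup>2) = (\<Sum>x\<in>S. (f x)\<^sup>2)"
    using rows by simp
  have inner: "(\<Sum>y\<in>S. 2 * f x * (P x y * f y)) = 2 * (f x)\<^sup>2" if "x \<in> S" for x
    by (simp only: sum_distrib_left[symmetric] harm[OF that, symmetric])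
      (simp add: power2_eq_square)
  have mixed: "(\<Sum>x\<in>S. \<Sum>y\<in>S. 2 * f x * (P x y * f y)) = 2 * (\<Sum>x\<in>S. (f x)\<^sup>2)"
    by (simp add: inner sum_distrib_left)
  have "(\<Sum>x\<in>S. \<Sum>y\<in>S. P x y * (f x - f y)\<^sup>2) =
      (\<Sum>x\<in>S. \<Sum>y\<in>S. P x y * (f x)\<^sup>2 + P x y * (f y)\<^sup>2 - 2 * f x * (P x y * f y))"
    by (intro sum.cong refl) (simp add: power2_eq_square algebra_simps)
  also have "\<dots> = 0"
    unfolding sum_subtractf sum.distrib rows columns mixed by simp
  finally show ?thesis .
qed

lemma harmonic_eq_along_transitions:
  fixes P :: "'a \<Rightarrow> 'a \<Rightarrow> real" and f :: "'a \<Rightarrow> real"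
  assumes fin: "finite S"
    and nonneg: "\<And>x y. x \<in> S \<Longrightarrow> y \<in> S \<Longrightarrow> 0 \<le> P x y"
    and sym: "\<And>x y. x \<in> S \<Longrightarrow> y \<in> S \<Longrightarrow> P x y = P y x"
    and row: "\<And>x. x \<in> S \<Longrightarrow> (\<Sum>y\<in>S. P x y) = 1"
    and harm: "\<And>x. x \<in> S \<Longrightarrow> f x = (\<Sum>y\<in>S. P x y * f y)"
    and step: "x \<in> S" "y \<in> S" "0 < P x y"
  shows "f x = f y"
proof -
  have "(\<Sum>x\<in>S. \<Sum>y\<in>S. P x y * (f x - f y)\<^sup>2) = 0"
    by (rule harmonic_dirichlet_form_zero[OF sym row harm])
  hence "(\<Sum>y\<in>S. P x y * (f x - f y)\<^sup>2) = 0"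
    using fin step(1) by (subst (asm) sum_nonneg_eq_0_iff) (auto intro!: sum_nonneg simp: nonneg)
  hence "P x y * (f x - f y)\<^sup>2 = 0"
    using fin step by (subst (asm) sum_nonneg_eq_0_iff) (auto simp: nonneg)
  thus ?thesis using step(3) by simp
qed

lemma uniform_invariant_if_symmetric:
  assumes "finite S" "S \<noteq> {}"
    and sym: "\<And>x y. x \<in> S \<Longrightarrow> y \<in> S \<Longrightarrow> P x y = P y x"
    and row: "\<And>x. x \<in> S \<Longrightarrow> (\<Sum>y\<in>S. P x y) = 1"
  shows "invariant_distribution S P (pmf_of_set S)"
  unfolding invariant_distribution_def
proof (intro conjI ballI)
  show "set_pmf (pmf_of_set S) \<subseteq> S" using assms(1,2) by simp
next
  fix y assume y: "y \<in> S"
  have "(\<Sum>x\<in>S. pmf (pmf_of_set S) x * P x y) = (\<Sum>x\<in>S. 1 / card S * P y x)"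
    using assms(1,2) y by (intro sum.cong refl) (simp add: sym)
  also have "\<dots> = 1 / card S"
    using y by (simp only: sum_distrib_left[symmetric] row mult_1_right)
  finally show "pmf (pmf_of_set S) y = (\<Sum>x\<in>S. pmf (pmf_of_set S) x * P x y)"
    using assms(1,2) y by simp
qed

text \<open>Reachability of a single state \<open>c\<close> from everywhere is a convenient form of irreducibility:
  for a symmetric matrix it is equivalent to it.\<close>

lemma invariant_unique_if_symmetric_irreducible:
  assumes fin: "finite S" and c: "c \<in> S"
    and nonneg: "\<And>x y. x \<in> S \<Longrightarrow> y \<in> S \<Longrightarrow> 0 \<le> P x y"
    and sym: "\<And>x y. x \<in> S \<Longrightarrow> y \<in> S \<Longrightarrow> P x y = P y x"
    and row: "\<And>x. x \<in> S \<Longrightarrow> (\<Sum>y\<in>S. P x y) = 1"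
    and reach: "\<And>x. x \<in> S \<Longrightarrow> (\<lambda>x y. x \<in> S \<and> y \<in> S \<and> 0 < P x y)\<^sup>*\<^sup>* x c"
    and inv: "invariant_distribution S P \<pi>"
  shows "\<pi> = pmf_of_set S"
proof -
  have supp: "set_pmf \<pi> \<subseteq> S" using inv by (simp add: invariant_distribution_def)
  have harm: "pmf \<pi> x = (\<Sum>y\<in>S. P x y * pmf \<pi> y)" if "x \<in> S" for x
  proof -
    have "pmf \<pi> x = (\<Sum>y\<in>S. pmf \<pi> y * P y x)"
      using inv that by (simp add: invariant_distribution_def)
    also have "\<dots> = (\<Sum>y\<in>S. P x y * pmf \<pi> y)"
      using that by (intro sum.cong refl) (simp add: sym)
    finally show ?thesis .
  qed
  have const: "pmf \<pi> x = pmf \<pi> c" if "x \<in> S" for x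
    using reach[OF that]
  proof (induction rule: converse_rtranclp_induct)
    case base
    show ?case ..
  next
    case (step y z)
    have "pmf \<pi> y = pmf \<pi> z"
      using harmonic_eq_along_transitions[of S P "pmf \<pi>", OF fin nonneg sym row harm] step(1)
      by blast
    thus ?case using step.IH by simp
  qed
  have "card S * pmf \<pi> c = (\<Sum>x\<in>S. pmf \<pi> x)"
    by (simp add: const)
  also have "\<dots> = 1" by (rule sum_pmf_eq_1[OF fin supp])
  finally have mass: "pmf \<pi> c = 1 / card S"
    by (metis eq_divide_imp mult.commute mult_zero_left zero_neq_one)
  show ?thesis
  proof (rule pmf_eqI)
    fix x
    show "pmf \<pi> x = pmf (pmf_of_set S) x"
    proof (cases "x \<in> S")
      case True
      have "S \<noteq> {}" using c by blast
      thus ?thesis using True const mass fin by simp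
    next
      case False
      hence "x \<notin> set_pmf \<pi>" and "S \<noteq> {}" using supp c by auto
      thus ?thesis using False fin by (simp add: set_pmf_iff)
    qed
  qed
qed

section \<open>The coagulation-fragmentation chain\<close>

lemma cf_transition_commute: "cf_transition N x y = cf_transition N y x"
  unfolding cf_transition_def
proof (intro sum.cong refl, clarify)
  fix i j :: nat
  have prod: "(\<Prod>k \<in> {1..N} - {i, j}. of_bool (y k = x k)) =
      (\<Prod>k \<in> {1..N} - {i, j}. of_bool (x k = y k) :: real)"
    by (intro prod.cong refl) auto
  show "1 / real N * (1 / (real N - 1)) * (1 / (real (x i) + real (x j) + 1)) *
        of_bool (x i + x j = y i + y j) * (\<Prod>k \<in> {1..N} - {i, j}. of_bool (y k = x k)) =
      1 / real N * (1 / (real N - 1)) * (1 / (real (y i) + real (y j) + 1)) *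
        of_bool (y i + y j = x i + x j) * (\<Prod>k \<in> {1..N} - {i, j}. of_bool (x k = y k))"
  proof (cases "x i + x j = y i + y j")
    case True
    hence "real (x i) + real (x j) = real (y i) + real (y j)"
      by (metis of_nat_add)
    thus ?thesis using True by (simp only: prod)
  next
    case False
    hence "y i + y j \<noteq> x i + x j" by (rule not_sym)
    thus ?thesis using False by (simp only: of_bool_eq mult_zero_left mult_zero_right)
  qed
qed

lemma cf_transition_pos:
  assumes ij: "i \<in> {1..N}" "j \<in> {1..N}" "i \<noteq> j"
    and pair: "x i + x j = y i + y j" and rest: "\<And>k. k \<in> {1..N} - {i, j} \<Longrightarrow> y k = x k"
  shows "0 < cf_transition N x y"
proof -
  have N: "real N > 1" using ij by auto
  have prod: "(\<Prod>k \<in> {1..N} - {i, j}. of_bool (y k = x k) :: real) = 1"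
    using rest by (intro prod.neutral) auto
  have fin: "finite {(i, j). i \<in> {1..N} \<and> j \<in> {1..N} \<and> i \<noteq> j}"
    by (rule finite_subset[of _ "{1..N} \<times> {1..N}"]) auto
  show ?thesis
    unfolding cf_transition_def
  proof (rule sum_pos2[OF fin, of "(i, j)"], goal_cases)
    case 1
    show ?case using ij by simp
  next
    case 2
    have "0 < 1 / real N * (1 / (real N - 1)) * (1 / (real (x i) + real (x j) + 1))"
      using N by (intro mult_pos_pos divide_pos_pos) auto
    thus ?case using pair by (simp only: prod case_prod_conv of_bool_eq simp_thms mult_1_right)
  next
    case (3 p)
    show ?case using N by (cases p) (auto intro!: divide_nonneg_nonneg mult_nonneg_nonneg prod_nonneg)
  qed
qed

definition corner :: "nat \<Rightarrow> nat \<Rightarrow> nat \<Rightarrow> nat" where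
  "corner N n = (\<lambda>i\<in>{1..N}. if i = 1 then n else 0)"

lemma corner_in_lattice_simplex:
  assumes "N \<ge> 1"
  shows "corner N n \<in> lattice_simplex N n"
  using assms by (auto simp: corner_def lattice_simplex_def)

lemma lattice_simplex_sum_split:
  assumes "x \<in> lattice_simplex N n" and "N \<ge> 1"
  shows "x 1 + (\<Sum>k\<in>{1..N} - {1}. x k) = n"
  using assms sum.remove[of "{1..N}" 1 x] by (auto simp: lattice_simplex_def)

lemma lattice_simplex_eq_corner:
  assumes x: "x \<in> lattice_simplex N n" and "N \<ge> 1"
    and zero: "\<And>j. j \<in> {1..N} - {1} \<Longrightarrow> x j = 0"
  shows "x = corner N n"
proof
  fix k
  have "x 1 = n"
    using lattice_simplex_sum_split[OF assms(1,2)] zero by simp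
  moreover have "x k = undefined" if "k \<notin> {1..N}"
    using x that by (auto simp: lattice_simplex_def)
  ultimately show "x k = corner N n k"
    using zero by (auto simp: corner_def)
qed

lemma coagulate_in_lattice_simplex:
  assumes x: "x \<in> lattice_simplex N n" and ij: "i \<in> {1..N}" "j \<in> {1..N}" "i \<noteq> j"
  shows "x(i := x i + x j, j := 0) \<in> lattice_simplex N n" (is "?y \<in> _")
proof -
  have split: "(\<Sum>k\<in>{1..N}. z k) = z i + z j + (\<Sum>k\<in>{1..N} - {i} - {j}. z k)"
    for z :: "nat \<Rightarrow> nat"
    using ij sum.remove[of "{1..N}" i z] sum.remove[of "{1..N} - {i}" j z] by simp
  have sum: "(\<Sum>k\<in>{1..N}. ?y k) = n"
    using x ij split[of x] split[of ?y] by (simp add: lattice_simplex_def)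
  \<comment> \<open>The bound \<open>n\<close> on each coordinate follows from the value of the sum.\<close>
  have "?y k \<le> n" if "k \<in> {1..N}" for k
    using member_le_sum[of k "{1..N}" ?y] that sum by simp
  moreover have "?y k = undefined" if "k \<notin> {1..N}" for k
  proof -
    have "x k = undefined" using x that by (auto simp: lattice_simplex_def)
    moreover have "k \<noteq> i" "k \<noteq> j" using ij that by auto
    ultimately show ?thesis by simp
  qed
  ultimately have "?y \<in> {1..N} \<rightarrow>\<^sub>E {0..n}"
    by (intro PiE_I) auto
  thus ?thesis using sum by (simp add: lattice_simplex_def)
qed

text \<open>As long as some coordinate other than the first is positive, coagulating it into the first
  is a transition of positive probability that brings the first coordinate closer to \<open>n\<close>.\<close>

lemma coagulation_reaches_corner:
  assumes N: "N \<ge> 1" and "x \<in> lattice_simplex N n"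
  shows "(\<lambda>x y. x \<in> lattice_simplex N n \<and> y \<in> lattice_simplex N n \<and> 0 < cf_transition N x y)\<^sup>*\<^sup>*
           x (corner N n)"
  using assms(2)
proof (induction "n - x 1" arbitrary: x rule: less_induct)
  case less
  show ?case
  proof (cases "\<forall>j\<in>{1..N} - {1}. x j = 0")
    case True
    hence "x = corner N n" using lattice_simplex_eq_corner[OF less.prems N] by blast
    thus ?thesis by simp
  next
    case False
    then obtain j where j: "j \<in> {1..N}" "1 \<noteq> j" "0 < x j" by fastforce
    let ?y = "x(1 := x 1 + x j, j := 0)"
    have one: "1 \<in> {1..N}" using N by simp
    have y: "?y \<in> lattice_simplex N n"
      by (rule coagulate_in_lattice_simplex[OF less.prems one j(1,2)])
    have "?y 1 \<le> n"
      using lattice_simplex_sum_split[OF y N] by linarith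
    hence "n - ?y 1 < n - x 1"
      using j by simp
    note less.hyps[OF this y]
    moreover have "0 < cf_transition N x ?y"
      by (rule cf_transition_pos[OF one j(1,2)]) (use j in auto)
    ultimately show ?thesis
      using less.prems y by (intro converse_rtranclp_into_rtranclp[of _ x ?y]) simp_all
  qed
qed

section \<open>The invariant distribution\<close>

theorem proposition2:
  fixes N n :: nat
  assumes "N \<ge> 2" and "n \<ge> 1"
  shows "invariant_distribution (lattice_simplex N n) (cf_transition N)
           (pmf_of_set (lattice_simplex N n)) \<and>
         (\<forall>\<pi>. invariant_distribution (lattice_simplex N n) (cf_transition N) \<pi> \<longrightarrow>
               \<pi> = pmf_of_set (lattice_simplex N n))"
proof (intro conjI allI impI)
  have N: "N \<ge> 1" using assms(1) by simp
  note row = sum_cf_transition[OF assms(1)]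
  show "invariant_distribution (lattice_simplex N n) (cf_transition N)
      (pmf_of_set (lattice_simplex N n))"
    by (rule uniform_invariant_if_symmetric[OF finite_lattice_simplex
          lattice_simplex_nonempty[OF N] cf_transition_commute row])
  fix \<pi>
  assume "invariant_distribution (lattice_simplex N n) (cf_transition N) \<pi>"
  thus "\<pi> = pmf_of_set (lattice_simplex N n)"
  proof (rule invariant_unique_if_symmetric_irreducible[OF finite_lattice_simplex
        corner_in_lattice_simplex[OF N], rotated -1])
  qed (auto intro: cf_transition_nonneg[OF N] cf_transition_commute row
      coagulation_reaches_corner[OF N])
qed

end
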